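(* Let $n$ be a positive integer and let $\lambda$ be any partition of $n$ of a particular type $\mathcal P$. Then $$ \omega(\lambda)\equiv n\pmod 4. $$
   Context: A "type" $\mathcal P$ of partitions is an arbitrary class of partitions (for example ordinary partitions, partitions into distinct parts, overpartitions, coloured partitions); each partition $\lambda$ of $n$ of type $\mathcal P$ has a finite multiset of positive integer parts with sum $n$. For such $\lambda$, $\omega(\lambda)$ is the sum of the odd parts of $\lambda$ minus the sum of the even parts of $\lambda$, with parts counted with multiplicity. *)

theory Defs
  imports "HOL-Library.Multiset" "HOL-Number_Theory.Cong"
begin

text \<open>
  A type of partitions is a class \<open>P\<close> of objects together with the map \<open>parts\<close> sending each object
  to its finite multiset of positive integer parts. The objects live in an arbitrary HOL type and
  \<open>parts\<close> need not be injective, so that overpartitions and coloured partitions, which carry more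
  data than their parts, are covered as well as classes of ordinary partitions (where \<open>parts\<close> is
  the identity).
\<close>
definition partition_type :: "'p set \<Rightarrow> ('p \<Rightarrow> nat multiset) \<Rightarrow> bool" where
  "partition_type P parts \<longleftrightarrow> (\<forall>l\<in>P. \<forall>k\<in>#parts l. 0 < k)"

definition partitions_of :: "'p set \<Rightarrow> ('p \<Rightarrow> nat multiset) \<Rightarrow> nat \<Rightarrow> 'p set" where
  "partitions_of P parts n = {l \<in> P. sum_mset (parts l) = n}"

text \<open>Integer-valued, since the sum of the even parts may exceed the sum of the odd parts.\<close>
definition omega :: "('p \<Rightarrow> nat multiset) \<Rightarrow> 'p \<Rightarrow> int" where
  "omega parts l =
     int (\<Sum>k\<in>#filter_mset odd (parts l). k) - int (\<Sum>k\<in>#filter_mset even (parts l). k)"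

end

theory Submission
  imports Defs
begin

text \<open>Let O and E be the sums of the odd and of the even parts. Then n = O + E by
  \<open>sum_mset_odd_plus_even\<close> and omega = O - E, so n - omega = 2E. As a sum of even
  numbers, E is itself even (\<open>even_sum_mset_filter_even\<close>), hence 4 divides 2E.\<close>

lemma sum_mset_odd_plus_even:
  fixes M :: "nat multiset"
  shows "sum_mset (filter_mset odd M) + sum_mset (filter_mset even M) = sum_mset M"
  by (induction M) auto

lemma even_sum_mset_filter_even:
  fixes M :: "nat multiset"
  shows "even (sum_mset (filter_mset even M))"
  by (induction M) auto

theorem theorem4p1:
  fixes P :: "'p set"
    and parts :: "'p \<Rightarrow> nat multiset"
    and n :: nat
    and l :: 'p
  assumes "partition_type P parts"
    and "n > 0"
    and "l \<in> partitions_of P parts n"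
  shows "[omega parts l = int n] (mod 4)"
proof -
  define e where "e = sum_mset (filter_mset even (parts l))"
  have "sum_mset (parts l) = n"
    using assms(3) by (simp add: partitions_of_def)
  then have "sum_mset (filter_mset odd (parts l)) + e = n"
    using sum_mset_odd_plus_even[of "parts l"] by (simp add: e_def)
  \<comment> \<open>The odd sum cancels, leaving the even sum counted twice.\<close>
  then have "int n - omega parts l = 2 * int e"
    by (auto simp: omega_def e_def)
  \<comment> \<open>Evenness of \<open>e\<close> supplies the second factor 2, which lifts the
    congruence from modulus 2 to modulus 4.\<close>
  moreover obtain c where "e = 2 * c"
    using even_sum_mset_filter_even[of "parts l"] unfolding e_def by (elim evenE)
  ultimately have "int n - omega parts l = 4 * int c"
    by simp
  then have "[int n = omega parts l] (mod 4)"
    by (simp add: cong_iff_dvd_diff)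
  then show ?thesis
    by (rule cong_sym)
qed

end
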